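(* The category $(RC\text{-}\mathbb{V}_n)_{*}$ of right-cancellable $\mathbb{V}_n$-algebras with fixed elements is isomorphic to the category $\mathbb{Y}_n$. Under this isomorphism (given by the functors $P$ and $Q$ described in the context), the strict right-cancellable $\mathbb{V}_n$-algebras (with fixed elements) correspond precisely to the triples $(A,\sigma,\rho)$ where $\sigma$ and $\rho$ are bijections. If $n=1$, then the groups (with fixed elements) correspond precisely to the triples $(A,\sigma,\rho)$ with $\sigma=\rho=1_A$.
   Context: Let $n\geq 1$ be a natural number. $\mathbb{V}_n$ is the variety of universal algebras whose signature consists of one $(n+1)$-ary operation $\theta$, binary operations $\alpha_1,\dots,\alpha_n$ and constants $e_1,\dots,e_n$, with defining identities $\alpha_i(a,a)=e_i$ ($1\le i\le n$) and $\theta(\alpha_1(a,b),\dots,\alpha_n(a,b),b)=a$. A $\mathbb{V}_n$-algebra $A$ is right-cancellable if for every $i$ ($1\le i\le n$) and all elements of $A$ $$\alpha_i(\theta(a_1,\dots,a_n,b),\theta(a_1',\dots,a_n',b))=\alpha_i(\theta(a_1,\dots,a_n,b'),\theta(a_1',\dots,a_n',b')).$$ Objects of $(RC\text{-}\mathbb{V}_n)_*$ are pairs $(A,u)$ of a right-cancellable $\mathbb{V}_n$-algebra $A$ and an element $u\in A$ (the fixed element); morphisms are homomorphisms preserving the fixed elements. For $b\in A$, $\theta_b:A^n\to A$ denotes the mapping $(a_1,\dots,a_n)\mapsto\theta(a_1,\dots,a_n,b)$. A $\mathbb{V}_n$-algebra $A$ is strict if $\theta_b$ is a bijection for every $b\in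 A$. For $n=1$, groups are considered as $\mathbb{V}_1$-algebras with $\theta(a,b)=ab$, $\alpha_1(a,b)=ab^{-1}$ and $e_1$ the unit of the group. Objects of $\mathbb{Y}_n$ are triples $(A,\sigma,\rho)$, where $A$ is a group and $\sigma:A^n\to A$, $\rho:A\to A^n$ are mappings (not necessarily homomorphisms) such that $\sigma\rho=1_A$. Morphisms $(A,\sigma,\rho)\to(A',\sigma',\rho')$ are group homomorphisms $f:A\to A'$ with $f\sigma=\sigma'f^n$ and $f^n\rho=\rho'f$. The isomorphism: the functor $P:(RC\text{-}\mathbb{V}_n)_{*}\to\mathbb{Y}_n$ sends $(A,u)$ to the triple $(A,\theta_u,(\alpha_1(-,u),\dots,\alpha_n(-,u)))$, where $A$ is equipped with the group operation $a\cdot_u b=\theta(\alpha_1(a,u),\dots,\alpha_n(a,u),b)$ (whose unit is $u$). The functor $Q:\mathbb{Y}_n\to(RC\text{-}\mathbb{V}_n)_{*}$ sends $(A,\sigma,\rho)$ to the set $A$ with operations $\theta(a_1,\dots,a_n,b)=\sigma(a_1,\dots,a_n)b$, $\alpha_i(a,b)=\pi_i\rho(ab^{-1})$, $e_i=\pi_i\rho(e)$, where $e$ is the unit of the group $A$ and $\pi_i:A^n\to A$ is the $i$-th projection, and with $e$ as the fixed element. Both functors act identically on underlying mappings.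
   Formalization: In the last sentence (n=1) the groups are taken with their unit as the fixed element: for a group with fixed element u, P gives σ(a)=au and ρ(a)=au^{-1}, which are identities only if u is the unit, so the claim fails for other fixed elements. *)

theory Defs
  imports "HOL-Algebra.Group"
begin

section \<open>Categories, functors and isomorphisms of categories\<close>

record ('o, 'm) cat =
  Obj :: "'o set"
  Arr :: "'m set"
  Dom :: "'m \<Rightarrow> 'o"
  Cod :: "'m \<Rightarrow> 'o"
  Id :: "'o \<Rightarrow> 'm"
  Comp :: "'m \<Rightarrow> 'm \<Rightarrow> 'm"

locale category =
  fixes C :: "('o, 'm) cat"
  assumes dom_obj: "f \<in> Arr C \<Longrightarrow> Dom C f \<in> Obj C"
    and cod_obj: "f \<in> Arr C \<Longrightarrow> Cod C f \<in> Obj C"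
    and id_arr: "X \<in> Obj C \<Longrightarrow> Id C X \<in> Arr C"
    and dom_id: "X \<in> Obj C \<Longrightarrow> Dom C (Id C X) = X"
    and cod_id: "X \<in> Obj C \<Longrightarrow> Cod C (Id C X) = X"
    and comp_arr: "\<lbrakk>f \<in> Arr C; g \<in> Arr C; Cod C f = Dom C g\<rbrakk> \<Longrightarrow> Comp C g f \<in> Arr C"
    and dom_comp: "\<lbrakk>f \<in> Arr C; g \<in> Arr C; Cod C f = Dom C g\<rbrakk> \<Longrightarrow> Dom C (Comp C g f) = Dom C f"
    and cod_comp: "\<lbrakk>f \<in> Arr C; g \<in> Arr C; Cod C f = Dom C g\<rbrakk> \<Longrightarrow> Cod C (Comp C g f) = Cod C g"
    and comp_id_right: "f \<in> Arr C \<Longrightarrow> Comp C f (Id C (Dom C f)) = f"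
    and comp_id_left: "f \<in> Arr C \<Longrightarrow> Comp C (Id C (Cod C f)) f = f"
    and comp_assoc: "\<lbrakk>f \<in> Arr C; g \<in> Arr C; h \<in> Arr C; Cod C f = Dom C g; Cod C g = Dom C h\<rbrakk>
      \<Longrightarrow> Comp C h (Comp C g f) = Comp C (Comp C h g) f"

record ('o, 'm, 'p, 'k) cfunctor =
  on_obj :: "'o \<Rightarrow> 'p"
  on_arr :: "'m \<Rightarrow> 'k"

locale is_functor = C: category C + D: category D
  for C :: "('o, 'm) cat" and D :: "('p, 'k) cat" +
  fixes F :: "('o, 'm, 'p, 'k) cfunctor"
  assumes map_obj: "X \<in> Obj C \<Longrightarrow> on_obj F X \<in> Obj D"
    and map_arr: "f \<in> Arr C \<Longrightarrow> on_arr F f \<in> Arr D"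
    and map_dom: "f \<in> Arr C \<Longrightarrow> Dom D (on_arr F f) = on_obj F (Dom C f)"
    and map_cod: "f \<in> Arr C \<Longrightarrow> Cod D (on_arr F f) = on_obj F (Cod C f)"
    and map_id: "X \<in> Obj C \<Longrightarrow> on_arr F (Id C X) = Id D (on_obj F X)"
    and map_comp: "\<lbrakk>f \<in> Arr C; g \<in> Arr C; Cod C f = Dom C g\<rbrakk>
      \<Longrightarrow> on_arr F (Comp C g f) = Comp D (on_arr F g) (on_arr F f)"

definition inverse_functors ::
    "('o, 'm) cat \<Rightarrow> ('p, 'k) cat \<Rightarrow> ('o, 'm, 'p, 'k) cfunctor \<Rightarrow> ('p, 'k, 'o, 'm) cfunctor \<Rightarrow> bool"
  where "inverse_functors C D F G \<longleftrightarrow>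
    is_functor C D F \<and> is_functor D C G \<and>
    (\<forall>X\<in>Obj C. on_obj G (on_obj F X) = X) \<and> (\<forall>f\<in>Arr C. on_arr G (on_arr F f) = f) \<and>
    (\<forall>Y\<in>Obj D. on_obj F (on_obj G Y) = Y) \<and> (\<forall>g\<in>Arr D. on_arr F (on_arr G g) = g)"

definition isomorphic_categories :: "('o, 'm) cat \<Rightarrow> ('p, 'k) cat \<Rightarrow> bool"
  where "isomorphic_categories C D \<longleftrightarrow> (\<exists>F G. inverse_functors C D F G)"

text \<open>The category whose objects are the sets with structure in \<open>Ob\<close>, with underlying sets given
  by \<open>U\<close>, and whose morphisms \<open>X \<rightarrow> Y\<close> are the mappings in \<open>H X Y\<close>. A morphism records its domain
  and codomain.\<close>

definition concrete_cat ::
    "'o set \<Rightarrow> ('o \<Rightarrow> 'a set) \<Rightarrow> ('o \<Rightarrow> 'o \<Rightarrow> ('a \<Rightarrow> 'a) set) \<Rightarrow> ('o, 'o \<times> ('a \<Rightarrow> 'a) \<times> 'o) cat"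
  where "concrete_cat Ob U H =
    \<lparr>Obj = Ob,
     Arr = {(X, f, Y) | X f Y. X \<in> Ob \<and> Y \<in> Ob \<and> f \<in> H X Y},
     Dom = (\<lambda>(X, f, Y). X),
     Cod = (\<lambda>(X, f, Y). Y),
     Id = (\<lambda>X. (X, \<lambda>a\<in>U X. a, X)),
     Comp = (\<lambda>(Y, g, Z) (X, f, Y'). (X, compose (U X) g f, Z))\<rparr>"

definition concrete_functor ::
    "('o \<Rightarrow> 'p) \<Rightarrow> ('o, 'o \<times> ('a \<Rightarrow> 'a) \<times> 'o, 'p, 'p \<times> ('a \<Rightarrow> 'a) \<times> 'p) cfunctor"
  where "concrete_functor F = \<lparr>on_obj = F, on_arr = (\<lambda>(X, f, Y). (F X, f, F Y))\<rparr>"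


section \<open>The category of right-cancellable \<open>\<V>\<^sub>n\<close>-algebras with fixed elements\<close>

text \<open>Algebras have a carrier set in an arbitrary type. Since equality of objects and of morphisms
  matters for an isomorphism of categories, every operation and mapping is extensional, that is,
  \<open>undefined\<close> outside its domain. An \<open>n\<close>-tuple is an extensional function on \<open>{1..n}\<close>.\<close>

definition tuples :: "nat \<Rightarrow> 'a set \<Rightarrow> (nat \<Rightarrow> 'a) set"
  where "tuples n A = {1..n} \<rightarrow>\<^sub>E A"

definition map_tuple :: "nat \<Rightarrow> ('a \<Rightarrow> 'b) \<Rightarrow> (nat \<Rightarrow> 'a) \<Rightarrow> nat \<Rightarrow> 'b"
  where "map_tuple n f a = (\<lambda>i\<in>{1..n}. f (a i))"

record 'a valg = "'a partial_object" +
  theta :: "(nat \<Rightarrow> 'a) \<Rightarrow> 'a \<Rightarrow> 'a"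
  alpha :: "nat \<Rightarrow> 'a \<Rightarrow> 'a \<Rightarrow> 'a"
  econst :: "nat \<Rightarrow> 'a"

definition vn_algebra :: "nat \<Rightarrow> 'a valg \<Rightarrow> bool"
  where "vn_algebra n A \<longleftrightarrow>
    theta A \<in> tuples n (carrier A) \<rightarrow>\<^sub>E carrier A \<rightarrow>\<^sub>E carrier A \<and>
    alpha A \<in> {1..n} \<rightarrow>\<^sub>E carrier A \<rightarrow>\<^sub>E carrier A \<rightarrow>\<^sub>E carrier A \<and>
    econst A \<in> {1..n} \<rightarrow>\<^sub>E carrier A \<and>
    (\<forall>i\<in>{1..n}. \<forall>a\<in>carrier A. alpha A i a a = econst A i) \<and>
    (\<forall>a\<in>carrier A. \<forall>b\<in>carrier A. theta A (\<lambda>i\<in>{1..n}. alpha A i a b) b = a)"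

definition right_cancellable :: "nat \<Rightarrow> 'a valg \<Rightarrow> bool"
  where "right_cancellable n A \<longleftrightarrow>
    (\<forall>i\<in>{1..n}. \<forall>a\<in>tuples n (carrier A). \<forall>a'\<in>tuples n (carrier A).
      \<forall>b\<in>carrier A. \<forall>b'\<in>carrier A.
        alpha A i (theta A a b) (theta A a' b) = alpha A i (theta A a b') (theta A a' b'))"

definition strict :: "nat \<Rightarrow> 'a valg \<Rightarrow> bool"
  where "strict n A \<longleftrightarrow>
    (\<forall>b\<in>carrier A. bij_betw (\<lambda>a. theta A a b) (tuples n (carrier A)) (carrier A))"

definition vn_hom :: "nat \<Rightarrow> 'a valg \<Rightarrow> 'a valg \<Rightarrow> ('a \<Rightarrow> 'a) set"
  where "vn_hom n A B = {f \<in> carrier A \<rightarrow>\<^sub>E carrier B.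
    (\<forall>a\<in>tuples n (carrier A). \<forall>b\<in>carrier A.
      f (theta A a b) = theta B (map_tuple n f a) (f b)) \<and>
    (\<forall>i\<in>{1..n}. \<forall>a\<in>carrier A. \<forall>b\<in>carrier A. f (alpha A i a b) = alpha B i (f a) (f b)) \<and>
    (\<forall>i\<in>{1..n}. f (econst A i) = econst B i)}"

type_synonym 'a pointed_valg = "'a valg \<times> 'a"

definition rcv_objects :: "nat \<Rightarrow> 'a pointed_valg set"
  where "rcv_objects n =
    {(A, u) | A u. vn_algebra n A \<and> right_cancellable n A \<and> u \<in> carrier A}"

definition RCVcat :: "nat \<Rightarrow> ('a pointed_valg, 'a pointed_valg \<times> ('a \<Rightarrow> 'a) \<times> 'a pointed_valg) cat"
  where "RCVcat n = concrete_cat (rcv_objects n) (\<lambda>(A, u). carrier A)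
    (\<lambda>(A, u) (B, v). {f \<in> vn_hom n A B. f u = v})"


section \<open>The category \<open>\<Y>\<^sub>n\<close>\<close>

type_synonym 'a ytriple = "'a monoid \<times> ((nat \<Rightarrow> 'a) \<Rightarrow> 'a) \<times> ('a \<Rightarrow> nat \<Rightarrow> 'a)"

text \<open>The library predicate \<^const>\<open>group\<close> leaves the multiplication unconstrained outside the carrier;
  the extensionality condition makes it a mapping on the carrier only.\<close>

definition y_objects :: "nat \<Rightarrow> 'a ytriple set"
  where "y_objects n = {(G, \<sigma>, \<rho>) | G \<sigma> \<rho>.
    group G \<and> mult G \<in> carrier G \<rightarrow>\<^sub>E carrier G \<rightarrow>\<^sub>E carrier G \<and>
    \<sigma> \<in> tuples n (carrier G) \<rightarrow>\<^sub>E carrier G \<and>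
    \<rho> \<in> carrier G \<rightarrow>\<^sub>E tuples n (carrier G) \<and>
    (\<forall>a\<in>carrier G. \<sigma> (\<rho> a) = a)}"

definition y_hom :: "nat \<Rightarrow> 'a ytriple \<Rightarrow> 'a ytriple \<Rightarrow> ('a \<Rightarrow> 'a) set"
  where "y_hom n = (\<lambda>(G, \<sigma>, \<rho>) (H, \<sigma>', \<rho>'). {f \<in> hom G H. f \<in> extensional (carrier G) \<and>
    (\<forall>a\<in>tuples n (carrier G). f (\<sigma> a) = \<sigma>' (map_tuple n f a)) \<and>
    (\<forall>a\<in>carrier G. map_tuple n f (\<rho> a) = \<rho>' (f a))})"

definition Ycat :: "nat \<Rightarrow> ('a ytriple, 'a ytriple \<times> ('a \<Rightarrow> 'a) \<times> 'a ytriple) cat"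
  where "Ycat n = concrete_cat (y_objects n) (\<lambda>(G, \<sigma>, \<rho>). carrier G) (y_hom n)"


section \<open>The functors \<open>P\<close> and \<open>Q\<close>\<close>

definition P_obj :: "nat \<Rightarrow> 'a pointed_valg \<Rightarrow> 'a ytriple"
  where "P_obj n = (\<lambda>(A, u).
    (\<lparr>carrier = carrier A,
      mult = (\<lambda>a\<in>carrier A. \<lambda>b\<in>carrier A. theta A (\<lambda>i\<in>{1..n}. alpha A i a u) b),
      one = u\<rparr>,
     \<lambda>a\<in>tuples n (carrier A). theta A a u,
     \<lambda>a\<in>carrier A. \<lambda>i\<in>{1..n}. alpha A i a u))"

definition Q_obj :: "nat \<Rightarrow> 'a ytriple \<Rightarrow> 'a pointed_valg"
  where "Q_obj n = (\<lambda>(G, \<sigma>, \<rho>).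
    (\<lparr>carrier = carrier G,
      theta = (\<lambda>a\<in>tuples n (carrier G). \<lambda>b\<in>carrier G. \<sigma> a \<otimes>\<^bsub>G\<^esub> b),
      alpha = (\<lambda>i\<in>{1..n}. \<lambda>a\<in>carrier G. \<lambda>b\<in>carrier G. \<rho> (a \<otimes>\<^bsub>G\<^esub> inv\<^bsub>G\<^esub> b) i),
      econst = (\<lambda>i\<in>{1..n}. \<rho> \<one>\<^bsub>G\<^esub> i)\<rparr>,
     \<one>\<^bsub>G\<^esub>))"

definition P_functor ::
    "nat \<Rightarrow> ('a pointed_valg, 'a pointed_valg \<times> ('a \<Rightarrow> 'a) \<times> 'a pointed_valg,
      'a ytriple, 'a ytriple \<times> ('a \<Rightarrow> 'a) \<times> 'a ytriple) cfunctor"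
  where "P_functor n = concrete_functor (P_obj n)"

definition Q_functor ::
    "nat \<Rightarrow> ('a ytriple, 'a ytriple \<times> ('a \<Rightarrow> 'a) \<times> 'a ytriple,
      'a pointed_valg, 'a pointed_valg \<times> ('a \<Rightarrow> 'a) \<times> 'a pointed_valg) cfunctor"
  where "Q_functor n = concrete_functor (Q_obj n)"


section \<open>Groups as \<open>\<V>\<^sub>1\<close>-algebras\<close>

definition v1_of_group :: "'a monoid \<Rightarrow> 'a valg"
  where "v1_of_group G =
    \<lparr>carrier = carrier G,
     theta = (\<lambda>a\<in>tuples 1 (carrier G). \<lambda>b\<in>carrier G. a 1 \<otimes>\<^bsub>G\<^esub> b),
     alpha = (\<lambda>i\<in>{1..1}. \<lambda>a\<in>carrier G. \<lambda>b\<in>carrier G. a \<otimes>\<^bsub>G\<^esub> inv\<^bsub>G\<^esub> b),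
     econst = (\<lambda>i\<in>{1..1}. \<one>\<^bsub>G\<^esub>)\<rparr>"

definition pointed_groups :: "'a pointed_valg set"
  where "pointed_groups = {(v1_of_group G, u) | G u. group G \<and> u \<in> carrier G}"

text \<open>Groups with their unit \<open>e\<^sub>1\<close> as the fixed element. In a group with fixed element \<open>u\<close> the
  mapping \<open>\<theta>\<^sub>u\<close> is the right translation \<open>a \<mapsto> a u\<close>, which is the identity only if
  \<open>u\<close> is the unit. Hence these are the only members of \<^const>\<open>pointed_groups\<close> that can
  correspond to a triple with \<open>\<sigma> = \<rho> = 1\<^sub>A\<close>.\<close>

definition unit_pointed_groups :: "'a pointed_valg set"
  where "unit_pointed_groups = {(A, u) \<in> pointed_groups. u = econst A 1}"

text \<open>The triples \<open>(A, \<sigma>, \<rho>)\<close> with \<open>\<sigma> = \<rho> = 1\<^sub>A\<close>, under the identification of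
  \<open>A\<^sup>1\<close> with \<open>A\<close>.\<close>

definition identity_triples :: "'a ytriple set"
  where "identity_triples = {(G, \<sigma>, \<rho>) \<in> y_objects 1.
    \<sigma> = (\<lambda>a\<in>tuples 1 (carrier G). a 1) \<and> \<rho> = (\<lambda>a\<in>carrier G. \<lambda>i\<in>{1..1}. a)}"

end

theory Submission
  imports Defs
begin

text \<open>The tuple \<open>\<alpha>(a, b) = (\<alpha>\<^sub>1(a, b), \<dots>, \<alpha>\<^sub>n(a, b))\<close> is a generalised quotient
  \<open>a b\<^sup>-\<^sup>1\<close>: the identity \<open>\<theta>(\<alpha>(a, b), b) = a\<close> says that it determines \<open>a\<close> once \<open>b\<close> is
  known. Right-cancellability says that the quotient of \<open>\<theta>(a, b)\<close> and \<open>\<theta>(a', b)\<close> does not depend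
  on \<open>b\<close>. Two instances carry everything. Since \<open>b = \<theta>((e\<^sub>1, \<dots>, e\<^sub>n), b)\<close>, the quotient
  \<open>\<alpha>(\<theta>(a, b), b)\<close> does not depend on \<open>b\<close> (\<open>quot_theta_base\<close>); and, as \<open>a \<cdot>\<^sub>u c\<close> is \<open>a\<close>
  with its base point moved from \<open>u\<close> to \<open>c\<close>, quotients are invariant under right translation,
  \<open>\<alpha>(a \<cdot>\<^sub>u c, b \<cdot>\<^sub>u c) = \<alpha>(a, b)\<close> (\<open>quot_translate\<close>). Associativity follows because an
  element is determined by its quotient with a known element, and \<open>(a \<cdot>\<^sub>u b) \<cdot>\<^sub>u c\<close> has
  quotient \<open>\<alpha>(a, u)\<close> with \<open>b \<cdot>\<^sub>u c\<close>.

  The same two facts recover the operations of \<open>A\<close> from the group: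
  \<open>\<theta>(a, b) = \<theta>\<^sub>u(a) \<cdot>\<^sub>u b\<close> and \<open>\<alpha>(a, b) = \<alpha>(a \<cdot>\<^sub>u b\<^sup>-\<^sup>1, u)\<close>, which is \<open>Q P = 1\<close>. That
  \<open>P Q = 1\<close> is immediate from the group laws, and the conditions on morphisms translate
  because either structure is given by a formula in the other. As all \<open>\<theta>\<^sub>b\<close> are composites of
  \<open>\<sigma> = \<theta>\<^sub>u\<close> with right translations of a group, strictness amounts to bijectivity of \<open>\<sigma>\<close>, and
  \<open>\<sigma> \<rho> = 1\<close> then makes \<open>\<rho>\<close> the inverse bijection.\<close>

section \<open>Concrete categories and functors between them\<close>

locale concrete_data =
  fixes Ob :: "'o set" and U :: "'o \<Rightarrow> 'a set" and H :: "'o \<Rightarrow> 'o \<Rightarrow> ('a \<Rightarrow> 'a) set"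
  assumes hom_fun: "\<lbrakk>X \<in> Ob; Y \<in> Ob; f \<in> H X Y\<rbrakk> \<Longrightarrow> f \<in> U X \<rightarrow>\<^sub>E U Y"
    and hom_id: "X \<in> Ob \<Longrightarrow> (\<lambda>a\<in>U X. a) \<in> H X X"
    and hom_compose: "\<lbrakk>X \<in> Ob; Y \<in> Ob; Z \<in> Ob; f \<in> H X Y; g \<in> H Y Z\<rbrakk> \<Longrightarrow> compose (U X) g f \<in> H X Z"
begin

lemma category_concrete_cat: "category (concrete_cat Ob U H)"
proof
  fix f g h
  assume f: "f \<in> Arr (concrete_cat Ob U H)" and g: "g \<in> Arr (concrete_cat Ob U H)"
    and h: "h \<in> Arr (concrete_cat Ob U H)"
    and fg: "Cod (concrete_cat Ob U H) f = Dom (concrete_cat Ob U H) g"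
    and gh: "Cod (concrete_cat Ob U H) g = Dom (concrete_cat Ob U H) h"
  obtain X f' Y g' Z h' W where eqs: "f = (X, f', Y)" "g = (Y, g', Z)" "h = (Z, h', W)"
    using f g h fg gh by (auto simp: concrete_cat_def)
  have "f' \<in> U X \<rightarrow> U Y"
    using f eqs hom_fun[of X Y f'] by (auto simp: concrete_cat_def)
  then have "compose (U X) h' (compose (U X) g' f') = compose (U X) (compose (U Y) h' g') f'"
    by (rule compose_assoc)
  then show "Comp (concrete_cat Ob U H) h (Comp (concrete_cat Ob U H) g f) =
      Comp (concrete_cat Ob U H) (Comp (concrete_cat Ob U H) h g) f"
    by (simp add: eqs concrete_cat_def)
next
  fix f
  assume f: "f \<in> Arr (concrete_cat Ob U H)"
  then obtain X f' Y where eqs: "f = (X, f', Y)" and maps: "f' \<in> U X \<rightarrow>\<^sub>E U Y"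
    using hom_fun by (auto simp: concrete_cat_def)
  have "f' \<in> U X \<rightarrow> U Y" "f' \<in> extensional (U X)" using maps by (auto simp: PiE_def)
  then have "compose (U X) f' (\<lambda>a\<in>U X. a) = f'" "compose (U X) (\<lambda>a\<in>U Y. a) f' = f'"
    by (auto intro: compose_Id Id_compose)
  then show "Comp (concrete_cat Ob U H) f (Id (concrete_cat Ob U H) (Dom (concrete_cat Ob U H) f)) = f"
    and "Comp (concrete_cat Ob U H) (Id (concrete_cat Ob U H) (Cod (concrete_cat Ob U H) f)) f = f"
    by (auto simp: eqs concrete_cat_def)
qed (auto simp: concrete_cat_def hom_id hom_compose)

end

lemma is_functor_concrete:
  assumes "concrete_data Ob U H" "concrete_data Ob' U' H'"
    and obj: "\<And>X. X \<in> Ob \<Longrightarrow> F X \<in> Ob'"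
    and und: "\<And>X. X \<in> Ob \<Longrightarrow> U' (F X) = U X"
    and hom: "\<And>X Y f. \<lbrakk>X \<in> Ob; Y \<in> Ob; f \<in> H X Y\<rbrakk> \<Longrightarrow> f \<in> H' (F X) (F Y)"
  shows "is_functor (concrete_cat Ob U H) (concrete_cat Ob' U' H') (concrete_functor F)"
proof -
  interpret C: category "concrete_cat Ob U H"
    using assms(1) by (rule concrete_data.category_concrete_cat)
  interpret D: category "concrete_cat Ob' U' H'"
    using assms(2) by (rule concrete_data.category_concrete_cat)
  show ?thesis
    by unfold_locales (auto simp: concrete_cat_def concrete_functor_def obj und hom)
qed

text \<open>Functors that act identically on underlying mappings are mutually inverse as soon as they
  are so on objects.\<close>

lemma inverse_functors_concrete:
  assumes data: "concrete_data Ob U H" "concrete_data Ob' U' H'"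
    and F: "\<And>X. X \<in> Ob \<Longrightarrow> F X \<in> Ob'" "\<And>X. X \<in> Ob \<Longrightarrow> U' (F X) = U X"
      "\<And>X Y f. \<lbrakk>X \<in> Ob; Y \<in> Ob; f \<in> H X Y\<rbrakk> \<Longrightarrow> f \<in> H' (F X) (F Y)"
    and G: "\<And>X. X \<in> Ob' \<Longrightarrow> G X \<in> Ob" "\<And>X. X \<in> Ob' \<Longrightarrow> U (G X) = U' X"
      "\<And>X Y f. \<lbrakk>X \<in> Ob'; Y \<in> Ob'; f \<in> H' X Y\<rbrakk> \<Longrightarrow> f \<in> H (G X) (G Y)"
    and GF: "\<And>X. X \<in> Ob \<Longrightarrow> G (F X) = X" and FG: "\<And>Y. Y \<in> Ob' \<Longrightarrow> F (G Y) = Y"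
  shows "inverse_functors (concrete_cat Ob U H) (concrete_cat Ob' U' H')
    (concrete_functor F) (concrete_functor G)"
  unfolding inverse_functors_def
proof (intro conjI)
  show "is_functor (concrete_cat Ob U H) (concrete_cat Ob' U' H') (concrete_functor F)"
    by (rule is_functor_concrete) (fact data F)+
  show "is_functor (concrete_cat Ob' U' H') (concrete_cat Ob U H) (concrete_functor G)"
    by (rule is_functor_concrete) (fact data G)+
qed (auto simp: concrete_cat_def concrete_functor_def GF FG)


section \<open>Tuples and homomorphisms\<close>

lemma tuples_nth: "\<lbrakk>a \<in> tuples n A; i \<in> {1..n}\<rbrakk> \<Longrightarrow> a i \<in> A"
  by (auto simp: tuples_def)

lemma tuples_restrict: "(\<And>i. i \<in> {1..n} \<Longrightarrow> f i \<in> A) \<Longrightarrow> (\<lambda>i\<in>{1..n}. f i) \<in> tuples n A"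
  by (auto simp: tuples_def)

lemma tuples_eqI:
  assumes "a \<in> tuples n A" "b \<in> tuples n B" "\<And>i. i \<in> {1..n} \<Longrightarrow> a i = b i"
  shows "a = b"
  using assms by (auto simp: tuples_def PiE_def intro: extensionalityI)

lemma map_tuple_tuples: "\<lbrakk>a \<in> tuples n A; f \<in> A \<rightarrow> B\<rbrakk> \<Longrightarrow> map_tuple n f a \<in> tuples n B"
  unfolding map_tuple_def by (rule tuples_restrict) (auto dest: tuples_nth)

lemma map_tuple_id:
  assumes "a \<in> tuples n A"
  shows "map_tuple n (\<lambda>x\<in>A. x) a = a"
proof (rule tuples_eqI)
  show "map_tuple n (\<lambda>x\<in>A. x) a \<in> tuples n A"
    using assms by (rule map_tuple_tuples) simp
  show "map_tuple n (\<lambda>x\<in>A. x) a i = a i" if "i \<in> {1..n}" for i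
    using that tuples_nth[OF assms that] by (simp add: map_tuple_def)
qed (rule assms)

lemma map_tuple_compose:
  assumes "a \<in> tuples n A"
  shows "map_tuple n (compose A g f) a = map_tuple n g (map_tuple n f a)"
  using tuples_nth[OF assms] by (auto simp: map_tuple_def compose_def)

lemma vn_algebra_closed:
  assumes "vn_algebra n A"
  shows "\<lbrakk>a \<in> tuples n (carrier A); b \<in> carrier A\<rbrakk> \<Longrightarrow> theta A a b \<in> carrier A"
    and "\<lbrakk>i \<in> {1..n}; x \<in> carrier A; b \<in> carrier A\<rbrakk> \<Longrightarrow> alpha A i x b \<in> carrier A"
    and "i \<in> {1..n} \<Longrightarrow> econst A i \<in> carrier A"
proof -
  have th: "theta A \<in> tuples n (carrier A) \<rightarrow> carrier A \<rightarrow> carrier A"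
    and al: "alpha A \<in> {1..n} \<rightarrow> carrier A \<rightarrow> carrier A \<rightarrow> carrier A"
    and ec: "econst A \<in> {1..n} \<rightarrow> carrier A"
    using assms by (auto simp: vn_algebra_def PiE_iff Pi_iff)
  show "theta A a b \<in> carrier A" if "a \<in> tuples n (carrier A)" "b \<in> carrier A"
    using th that by blast
  show "alpha A i x b \<in> carrier A" if "i \<in> {1..n}" "x \<in> carrier A" "b \<in> carrier A"
    using al that by blast
  show "econst A i \<in> carrier A" if "i \<in> {1..n}"
    using ec that by blast
qed

lemma concrete_data_rcv:
  "concrete_data (rcv_objects n) (\<lambda>(A, u). carrier A) (\<lambda>(A, u) (B, v). {f \<in> vn_hom n A B. f u = v})"
proof (unfold_locales, goal_cases)
  case (1 X Y f)
  then show ?case by (auto simp: vn_hom_def)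
next
  case (2 X)
  then obtain A u where X: "X = (A, u)" and A: "vn_algebra n A" and u: "u \<in> carrier A"
    by (auto simp: rcv_objects_def)
  show ?case
    unfolding X using u
    by (auto simp: vn_hom_def map_tuple_id vn_algebra_closed[OF A])
next
  case (3 X Y Z f g)
  then obtain A u B v C w where eqs: "X = (A, u)" "Y = (B, v)" "Z = (C, w)"
    and A: "vn_algebra n A" and u: "u \<in> carrier A"
    by (auto simp: rcv_objects_def)
  have f: "f \<in> carrier A \<rightarrow> carrier B"
    and f_theta: "\<And>a b. \<lbrakk>a \<in> tuples n (carrier A); b \<in> carrier A\<rbrakk> \<Longrightarrow>
      f (theta A a b) = theta B (map_tuple n f a) (f b)"
    and f_rest: "\<And>i a b. \<lbrakk>i \<in> {1..n}; a \<in> carrier A; b \<in> carrier A\<rbrakk> \<Longrightarrow>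
      f (alpha A i a b) = alpha B i (f a) (f b)"
      "\<And>i. i \<in> {1..n} \<Longrightarrow> f (econst A i) = econst B i" "f u = v"
    using 3 by (auto simp: eqs vn_hom_def)
  have g: "g \<in> carrier B \<rightarrow> carrier C"
    and g_theta: "\<And>a b. \<lbrakk>a \<in> tuples n (carrier B); b \<in> carrier B\<rbrakk> \<Longrightarrow>
      g (theta B a b) = theta C (map_tuple n g a) (g b)"
    and g_rest: "\<And>i a b. \<lbrakk>i \<in> {1..n}; a \<in> carrier B; b \<in> carrier B\<rbrakk> \<Longrightarrow>
      g (alpha B i a b) = alpha C i (g a) (g b)"
      "\<And>i. i \<in> {1..n} \<Longrightarrow> g (econst B i) = econst C i" "g v = w"
    using 3 by (auto simp: eqs vn_hom_def)
  have fB: "f x \<in> carrier B" if "x \<in> carrier A" for x using f that by blast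
  have "compose (carrier A) g f \<in> carrier A \<rightarrow>\<^sub>E carrier C"
    using f g by (auto simp: compose_def)
  moreover have "compose (carrier A) g f (theta A a b) =
      theta C (map_tuple n (compose (carrier A) g f) a) (compose (carrier A) g f b)"
    if "a \<in> tuples n (carrier A)" "b \<in> carrier A" for a b
    using that
    by (simp add: compose_eq vn_algebra_closed[OF A] map_tuple_compose f_theta g_theta
        map_tuple_tuples[OF _ f] fB)
  moreover have "compose (carrier A) g f (alpha A i a b) =
      alpha C i (compose (carrier A) g f a) (compose (carrier A) g f b)"
    if "i \<in> {1..n}" "a \<in> carrier A" "b \<in> carrier A" for i a b
    unfolding compose_eq[OF vn_algebra_closed(2)[OF A that]] compose_eq[OF that(2)]
      compose_eq[OF that(3)]
    using that by (simp only: f_rest g_rest fB)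
  moreover have "compose (carrier A) g f (econst A i) = econst C i" if "i \<in> {1..n}" for i
    unfolding compose_eq[OF vn_algebra_closed(3)[OF A that]]
    using that by (simp only: f_rest g_rest)
  moreover have "compose (carrier A) g f u = w"
    using u f_rest(3) g_rest(3) by (simp add: compose_eq)
  ultimately show ?case
    unfolding eqs vn_hom_def by simp
qed

lemma concrete_data_y: "concrete_data (y_objects n) (\<lambda>(G, \<sigma>, \<rho>). carrier G) (y_hom n)"
proof (unfold_locales, goal_cases)
  case (1 X Y f)
  then show ?case by (auto simp: y_hom_def hom_def PiE_def split: prod.splits)
next
  case (2 X)
  then obtain G \<sigma> \<rho> where X: "X = (G, \<sigma>, \<rho>)" and "group G"
    and s: "\<sigma> \<in> tuples n (carrier G) \<rightarrow>\<^sub>E carrier G" and r: "\<rho> \<in> carrier G \<rightarrow>\<^sub>E tuples n (carrier G)"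
    by (auto simp: y_objects_def)
  interpret group G by fact
  have "\<sigma> a \<in> carrier G" if "a \<in> tuples n (carrier G)" for a using s that by blast
  moreover have "\<rho> a \<in> tuples n (carrier G)" if "a \<in> carrier G" for a using r that by blast
  ultimately show ?case
    unfolding X by (auto simp: y_hom_def hom_def map_tuple_id)
next
  case (3 X Y Z f g)
  then obtain G s r G' s' r' G'' s'' r'' where eqs: "X = (G, s, r)" "Y = (G', s', r')" "Z = (G'', s'', r'')"
    and s: "s \<in> tuples n (carrier G) \<rightarrow>\<^sub>E carrier G" and r: "r \<in> carrier G \<rightarrow>\<^sub>E tuples n (carrier G)"
    and "group G"
    by (auto simp: y_objects_def)
  interpret group G by fact
  have fh: "f \<in> hom G G'" and gh: "g \<in> hom G' G''"
    using 3 by (auto simp: eqs y_hom_def)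
  have f: "f \<in> carrier G \<rightarrow> carrier G'"
    using fh by (auto simp: hom_def)
  have fG: "f x \<in> carrier G'" if "x \<in> carrier G" for x using f that by blast
  have sG: "s a \<in> carrier G" if "a \<in> tuples n (carrier G)" for a using s that by blast
  have rG: "r a \<in> tuples n (carrier G)" if "a \<in> carrier G" for a using r that by blast
  have "compose (carrier G) g f \<in> hom G G''"
    using hom_compose[OF fh gh] by (auto simp: hom_def compose_def)
  moreover have "compose (carrier G) g f (s a) = s'' (map_tuple n (compose (carrier G) g f) a)"
    if "a \<in> tuples n (carrier G)" for a
    using that 3 by (simp add: eqs y_hom_def compose_eq sG map_tuple_compose map_tuple_tuples[OF _ f])
  moreover have "map_tuple n (compose (carrier G) g f) (r a) = r'' (compose (carrier G) g f a)"
    if "a \<in> carrier G" for a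
    using that 3 by (simp add: eqs y_hom_def compose_eq map_tuple_compose[OF rG] fG)
  ultimately show ?case
    by (simp add: eqs y_hom_def)
qed


section \<open>The group of a right-cancellable algebra\<close>

locale pointed_rc_algebra =
  fixes n :: nat and A :: "'a valg" and u :: 'a
  assumes alg: "vn_algebra n A"
    and rc: "right_cancellable n A"
    and point_closed: "u \<in> carrier A"
begin

lemmas theta_closed = vn_algebra_closed(1)[OF alg]
  and alpha_closed = vn_algebra_closed(2)[OF alg]
  and econst_closed = vn_algebra_closed(3)[OF alg]

definition quot :: "'a \<Rightarrow> 'a \<Rightarrow> nat \<Rightarrow> 'a"
  where "quot a b = (\<lambda>i\<in>{1..n}. alpha A i a b)"

definition pmult :: "'a \<Rightarrow> 'a \<Rightarrow> 'a"
  where "pmult a b = theta A (quot a u) b"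

lemma quot_nth: "i \<in> {1..n} \<Longrightarrow> quot a b i = alpha A i a b"
  by (simp add: quot_def)

lemma quot_closed: "\<lbrakk>a \<in> carrier A; b \<in> carrier A\<rbrakk> \<Longrightarrow> quot a b \<in> tuples n (carrier A)"
  unfolding quot_def by (rule tuples_restrict) (rule alpha_closed)

lemma pmult_closed: "\<lbrakk>a \<in> carrier A; b \<in> carrier A\<rbrakk> \<Longrightarrow> pmult a b \<in> carrier A"
  by (simp add: pmult_def theta_closed quot_closed point_closed)

lemma theta_quot: "\<lbrakk>a \<in> carrier A; b \<in> carrier A\<rbrakk> \<Longrightarrow> theta A (quot a b) b = a"
  using alg unfolding vn_algebra_def quot_def by blast

lemma alpha_self: "\<lbrakk>i \<in> {1..n}; a \<in> carrier A\<rbrakk> \<Longrightarrow> alpha A i a a = econst A i"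
  using alg unfolding vn_algebra_def by blast

lemma quot_self: "a \<in> carrier A \<Longrightarrow> quot a a = (\<lambda>i\<in>{1..n}. econst A i)"
  unfolding quot_def by (intro restrict_ext alpha_self)

lemma quot_self_eq: "\<lbrakk>a \<in> carrier A; b \<in> carrier A\<rbrakk> \<Longrightarrow> quot a a = quot b b"
  by (simp add: quot_self)

lemma quot_theta:
  assumes "a \<in> tuples n (carrier A)" "a' \<in> tuples n (carrier A)" "b \<in> carrier A" "b' \<in> carrier A"
  shows "quot (theta A a b) (theta A a' b) = quot (theta A a b') (theta A a' b')"
  unfolding quot_def using rc assms unfolding right_cancellable_def
  by (intro restrict_ext) blast

text \<open>The tuple of constants is \<open>quot b b\<close> for every \<open>b\<close>, so both base points on the right of
  the quotients are themselves values of \<open>\<theta>\<close> at that tuple.\<close>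

lemma quot_theta_base:
  assumes "a \<in> tuples n (carrier A)" "b \<in> carrier A" "b' \<in> carrier A"
  shows "quot (theta A a b) b = quot (theta A a b') b'"
proof -
  have "quot (theta A a b) (theta A (quot b b) b) = quot (theta A a b') (theta A (quot b b) b')"
    using assms by (intro quot_theta quot_closed)
  then show ?thesis
    using theta_quot[of b b] theta_quot[of b' b'] quot_self_eq[of b b'] assms by simp
qed

lemma quot_translate:
  assumes "a \<in> carrier A" "b \<in> carrier A" "c \<in> carrier A"
  shows "quot (pmult a c) (pmult b c) = quot a b"
proof -
  have "quot (pmult a c) (pmult b c) = quot (theta A (quot a u) u) (theta A (quot b u) u)"
    unfolding pmult_def using assms point_closed by (intro quot_theta quot_closed)
  then show ?thesis
    using assms point_closed by (simp add: theta_quot)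
qed

lemma pmult_point_left: "b \<in> carrier A \<Longrightarrow> pmult u b = b"
  using quot_self_eq[of u b] theta_quot[of b b] point_closed by (simp add: pmult_def)

lemma pmult_point_right: "a \<in> carrier A \<Longrightarrow> pmult a u = a"
  using theta_quot point_closed by (simp add: pmult_def)

lemma pmult_assoc:
  assumes "a \<in> carrier A" "b \<in> carrier A" "c \<in> carrier A"
  shows "pmult (pmult a b) c = pmult a (pmult b c)"
proof -
  have "quot (pmult (pmult a b) c) (pmult b c) = quot (pmult a b) b"
    using assms by (simp add: quot_translate pmult_closed)
  also have "\<dots> = quot (pmult a b) (pmult u b)"
    using assms by (simp add: pmult_point_left)
  also have "\<dots> = quot a u"
    using assms point_closed by (simp add: quot_translate)
  finally show ?thesis
    using theta_quot[of "pmult (pmult a b) c" "pmult b c"] assms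
    by (simp add: pmult_closed pmult_def[of a "pmult b c"])
qed

text \<open>A left inverse \<open>x\<close> of \<open>b\<close> must satisfy \<open>\<theta>(\<alpha>(x, u), b) = u\<close>, which holds when \<open>\<alpha>(x, u)\<close> is
  \<open>\<alpha>(u, b)\<close>; the change of base point realises this tuple as a quotient with \<open>u\<close>.\<close>

lemma pmult_inverse_left:
  assumes "b \<in> carrier A"
  shows "theta A (quot u b) u \<in> carrier A" "pmult (theta A (quot u b) u) b = u"
proof -
  have q: "quot u b \<in> tuples n (carrier A)"
    using assms by (simp add: quot_closed point_closed)
  show "theta A (quot u b) u \<in> carrier A"
    using q by (simp add: theta_closed point_closed)
  have "quot (theta A (quot u b) u) u = quot (theta A (quot u b) b) b"
    using q assms by (intro quot_theta_base) (auto simp: point_closed)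
  also have "\<dots> = quot u b"
    using assms by (simp add: theta_quot point_closed)
  finally show "pmult (theta A (quot u b) u) b = u"
    using assms by (simp add: pmult_def theta_quot point_closed)
qed

lemma P_obj_eq:
  "P_obj n (A, u) =
    (\<lparr>carrier = carrier A, mult = (\<lambda>a\<in>carrier A. \<lambda>b\<in>carrier A. pmult a b), one = u\<rparr>,
     \<lambda>a\<in>tuples n (carrier A). theta A a u, \<lambda>a\<in>carrier A. quot a u)"
  by (simp add: P_obj_def pmult_def quot_def)

lemma group_P: "group (fst (P_obj n (A, u)))"
proof (rule groupI)
  fix b
  assume "b \<in> carrier (fst (P_obj n (A, u)))"
  then have b: "b \<in> carrier A" by (simp add: P_obj_eq)
  show "\<exists>a\<in>carrier (fst (P_obj n (A, u))). a \<otimes>\<^bsub>fst (P_obj n (A, u))\<^esub> b = \<one>\<^bsub>fst (P_obj n (A, u))\<^esub>"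
    using pmult_inverse_left[OF b] b by (intro bexI[of _ "theta A (quot u b) u"]) (simp_all add: P_obj_eq)
qed (simp_all add: P_obj_eq pmult_closed point_closed pmult_assoc pmult_point_left)

lemma P_obj_closed: "P_obj n (A, u) \<in> y_objects n"
  using group_P unfolding P_obj_eq y_objects_def
  by (auto simp: pmult_closed theta_closed quot_closed theta_quot point_closed)

text \<open>By the change of base point, \<open>\<theta>(a, u)\<close> has the same quotient with \<open>u\<close> as \<open>\<theta>(a, b)\<close> has
  with \<open>b\<close>, and \<open>pmult\<close> re-attaches that quotient to \<open>b\<close>. Here \<open>a\<close> need not itself be a
  quotient, since \<open>\<theta>\<^sub>u\<close> may fail to be injective.\<close>

lemma theta_eq_pmult:
  assumes "a \<in> tuples n (carrier A)" "b \<in> carrier A"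
  shows "pmult (theta A a u) b = theta A a b"
proof -
  have "quot (theta A a u) u = quot (theta A a b) b"
    using assms by (intro quot_theta_base) (auto simp: point_closed)
  then show ?thesis
    using theta_quot[of "theta A a b" b] assms by (simp add: pmult_def theta_closed)
qed

lemma Q_P: "Q_obj n (P_obj n (A, u)) = (A, u)"
proof -
  let ?G = "fst (P_obj n (A, u))"
  interpret G: group ?G by (rule group_P)
  have car: "carrier ?G = carrier A" and one: "\<one>\<^bsub>?G\<^esub> = u" by (simp_all add: P_obj_eq)
  have mult: "a \<otimes>\<^bsub>?G\<^esub> b = pmult a b" if "a \<in> carrier A" "b \<in> carrier A" for a b
    using that by (simp add: P_obj_eq)
  have inv: "inv\<^bsub>?G\<^esub> b \<in> carrier A" "pmult (inv\<^bsub>?G\<^esub> b) b = u" if "b \<in> carrier A" for b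
    using that G.inv_closed[of b] G.l_inv[of b] by (simp_all add: car one mult)
  \<comment> \<open>Right translation by \<open>b\<close> carries the pair \<open>(a b\<^sup>-\<^sup>1, u)\<close> to \<open>(a, b)\<close>.\<close>
  have quot_div: "quot (pmult a (inv\<^bsub>?G\<^esub> b)) u = quot a b"
    if ab: "a \<in> carrier A" "b \<in> carrier A" for a b
  proof -
    have "quot (pmult a (inv\<^bsub>?G\<^esub> b)) u = quot (pmult (pmult a (inv\<^bsub>?G\<^esub> b)) b) (pmult u b)"
      using ab inv point_closed by (simp add: quot_translate pmult_closed)
    also have "\<dots> = quot a b"
      using ab inv by (simp add: pmult_assoc pmult_point_left pmult_point_right)
    finally show ?thesis .
  qed
  have th: "theta A \<in> extensional (tuples n (carrier A))"
      "\<And>a. a \<in> tuples n (carrier A) \<Longrightarrow> theta A a \<in> extensional (carrier A)"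
    and al: "alpha A \<in> extensional {1..n}"
      "\<And>i. i \<in> {1..n} \<Longrightarrow> alpha A i \<in> extensional (carrier A)"
      "\<And>i a. \<lbrakk>i \<in> {1..n}; a \<in> carrier A\<rbrakk> \<Longrightarrow> alpha A i a \<in> extensional (carrier A)"
    and ec: "econst A \<in> extensional {1..n}"
    using alg by (auto simp: vn_algebra_def PiE_iff)
  have "theta (fst (Q_obj n (P_obj n (A, u)))) = theta A"
  proof -
    have "(\<lambda>a\<in>tuples n (carrier A). \<lambda>b\<in>carrier A. pmult (theta A a u) b) =
        (\<lambda>a\<in>tuples n (carrier A). \<lambda>b\<in>carrier A. theta A a b)"
      by (intro restrict_ext theta_eq_pmult)
    also have "\<dots> = (\<lambda>a\<in>tuples n (carrier A). theta A a)"
      by (intro restrict_ext extensional_restrict th)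
    also have "\<dots> = theta A" using th by (simp add: extensional_restrict)
    finally show ?thesis
      by (simp add: P_obj_eq Q_obj_def theta_closed point_closed cong: restrict_cong)
  qed
  moreover have "alpha (fst (Q_obj n (P_obj n (A, u)))) = alpha A"
  proof -
    have "(\<lambda>i\<in>{1..n}. \<lambda>a\<in>carrier A. \<lambda>b\<in>carrier A. quot (pmult a (inv\<^bsub>?G\<^esub> b)) u i) =
        (\<lambda>i\<in>{1..n}. \<lambda>a\<in>carrier A. \<lambda>b\<in>carrier A. alpha A i a b)"
      by (intro restrict_ext) (simp add: quot_div quot_nth)
    also have "\<dots> = (\<lambda>i\<in>{1..n}. \<lambda>a\<in>carrier A. alpha A i a)"
      by (intro restrict_ext extensional_restrict al)
    also have "\<dots> = (\<lambda>i\<in>{1..n}. alpha A i)"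
      by (intro restrict_ext extensional_restrict al)
    also have "\<dots> = alpha A" using al by (simp add: extensional_restrict)
    finally show ?thesis
      using inv(1) by (simp add: P_obj_eq Q_obj_def pmult_closed cong: restrict_cong)
  qed
  moreover have "econst (fst (Q_obj n (P_obj n (A, u)))) = econst A"
  proof -
    have "(\<lambda>i\<in>{1..n}. quot u u i) = (\<lambda>i\<in>{1..n}. econst A i)"
      by (intro restrict_ext) (simp add: quot_self point_closed)
    also have "\<dots> = econst A" using ec by (simp add: extensional_restrict)
    finally show ?thesis
      by (simp add: P_obj_eq Q_obj_def point_closed)
  qed
  ultimately show ?thesis
    by (simp add: P_obj_eq Q_obj_def)
qed

end

lemma rcv_objects_iff: "(A, u) \<in> rcv_objects n \<longleftrightarrow> pointed_rc_algebra n A u"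
  by (simp add: rcv_objects_def pointed_rc_algebra_def)

text \<open>The multiplication and the unit of the group of \<open>(A, u)\<close> are built from \<open>\<theta>\<close>, \<open>\<alpha>\<^sub>i\<close>
  and \<open>u\<close>, so preserving the fixed element makes \<open>f\<close> a group homomorphism.\<close>

lemma P_hom:
  assumes "pointed_rc_algebra n A u" "pointed_rc_algebra n B v" "f \<in> vn_hom n A B" "f u = v"
  shows "f \<in> y_hom n (P_obj n (A, u)) (P_obj n (B, v))"
proof -
  interpret A: pointed_rc_algebra n A u by fact
  interpret B: pointed_rc_algebra n B v by fact
  have f: "f \<in> carrier A \<rightarrow> carrier B" and ext: "f \<in> extensional (carrier A)"
    and th: "\<And>a b. \<lbrakk>a \<in> tuples n (carrier A); b \<in> carrier A\<rbrakk> \<Longrightarrow>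
      f (theta A a b) = theta B (map_tuple n f a) (f b)"
    and al: "\<And>i a b. \<lbrakk>i \<in> {1..n}; a \<in> carrier A; b \<in> carrier A\<rbrakk> \<Longrightarrow>
      f (alpha A i a b) = alpha B i (f a) (f b)"
    using assms(3) by (auto simp: vn_hom_def PiE_def)
  have fB: "f a \<in> carrier B" if "a \<in> carrier A" for a using f that by blast
  have quot: "map_tuple n f (A.quot a u) = B.quot (f a) v" if "a \<in> carrier A" for a
    unfolding map_tuple_def B.quot_def
    by (intro restrict_ext) (use that in \<open>simp only: A.quot_nth al A.point_closed assms(4)\<close>)
  have "f (A.pmult a b) = B.pmult (f a) (f b)" if "a \<in> carrier A" "b \<in> carrier A" for a b
    using that by (simp add: A.pmult_def B.pmult_def th A.quot_closed A.point_closed quot)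
  then show ?thesis
    unfolding A.P_obj_eq B.P_obj_eq y_hom_def
    using f ext th quot fB A.point_closed assms(4)
    by (auto simp: hom_def A.pmult_closed map_tuple_tuples)
qed


section \<open>The algebra of a triple\<close>

locale y_triple = group G for n :: nat and G :: "'a monoid" (structure) and \<sigma> \<rho> +
  assumes mult_ext: "mult G \<in> carrier G \<rightarrow>\<^sub>E carrier G \<rightarrow>\<^sub>E carrier G"
    and sigma_fun: "\<sigma> \<in> tuples n (carrier G) \<rightarrow>\<^sub>E carrier G"
    and rho_fun: "\<rho> \<in> carrier G \<rightarrow>\<^sub>E tuples n (carrier G)"
    and sigma_rho: "a \<in> carrier G \<Longrightarrow> \<sigma> (\<rho> a) = a"
begin

lemma sigma_closed: "a \<in> tuples n (carrier G) \<Longrightarrow> \<sigma> a \<in> carrier G"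
  using sigma_fun by blast

lemma rho_closed: "a \<in> carrier G \<Longrightarrow> \<rho> a \<in> tuples n (carrier G)"
  using rho_fun by blast

lemmas rho_nth_closed = tuples_nth[OF rho_closed]

lemma restrict_rho: "a \<in> carrier G \<Longrightarrow> (\<lambda>i\<in>{1..n}. \<rho> a i) = \<rho> a"
  using rho_closed unfolding tuples_def by (metis PiE_restrict)

lemma mult_inv_cancel: "\<lbrakk>a \<in> carrier G; b \<in> carrier G\<rbrakk> \<Longrightarrow> a \<otimes> inv b \<otimes> b = a"
  by (simp add: m_assoc)

lemma Q_obj_rc: "pointed_rc_algebra n (fst (Q_obj n (G, \<sigma>, \<rho>))) \<one>"
proof
  let ?A = "fst (Q_obj n (G, \<sigma>, \<rho>))"
  have "theta ?A (\<lambda>i\<in>{1..n}. alpha ?A i a b) b = a" if "a \<in> carrier G" "b \<in> carrier G" for a b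
  proof -
    have "(\<lambda>i\<in>{1..n}. alpha ?A i a b) = \<rho> (a \<otimes> inv b)"
      using that restrict_rho[of "a \<otimes> inv b"] by (simp add: Q_obj_def cong: restrict_cong)
    then show ?thesis
      using that by (simp add: Q_obj_def rho_closed sigma_rho mult_inv_cancel)
  qed
  then show "vn_algebra n ?A"
    by (auto simp: vn_algebra_def Q_obj_def sigma_closed rho_nth_closed)
  have "(\<sigma> a \<otimes> b) \<otimes> inv (\<sigma> a' \<otimes> b) = \<sigma> a \<otimes> inv (\<sigma> a')"
    if "a \<in> tuples n (carrier G)" "a' \<in> tuples n (carrier G)" "b \<in> carrier G" for a a' b
  proof -
    have "(\<sigma> a \<otimes> b) \<otimes> inv (\<sigma> a' \<otimes> b) = \<sigma> a \<otimes> (b \<otimes> inv b) \<otimes> inv (\<sigma> a')"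
      using that by (simp only: inv_mult_group m_assoc sigma_closed inv_closed m_closed)
    then show ?thesis using that by (simp add: sigma_closed)
  qed
  then show "right_cancellable n ?A"
    by (simp add: right_cancellable_def Q_obj_def sigma_closed)
qed (simp add: Q_obj_def)

lemma Q_obj_closed: "Q_obj n (G, \<sigma>, \<rho>) \<in> rcv_objects n"
  using Q_obj_rc by (simp add: Q_obj_def rcv_objects_iff)

lemma P_Q: "P_obj n (Q_obj n (G, \<sigma>, \<rho>)) = (G, \<sigma>, \<rho>)"
proof -
  have ext: "mult G \<in> extensional (carrier G)"
    "\<And>a. a \<in> carrier G \<Longrightarrow> mult G a \<in> extensional (carrier G)"
    using mult_ext by (auto simp: PiE_iff)
  have tup: "(\<lambda>i\<in>{1..n}. alpha (fst (Q_obj n (G, \<sigma>, \<rho>))) i a \<one>) = \<rho> a" if "a \<in> carrier G" for a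
    using that restrict_rho[of a] by (simp add: Q_obj_def cong: restrict_cong)
  have "(\<lambda>a\<in>carrier G. \<lambda>b\<in>carrier G. theta (fst (Q_obj n (G, \<sigma>, \<rho>)))
      (\<lambda>i\<in>{1..n}. alpha (fst (Q_obj n (G, \<sigma>, \<rho>))) i a \<one>) b) =
      (\<lambda>a\<in>carrier G. \<lambda>b\<in>carrier G. a \<otimes> b)"
    by (intro restrict_ext) (simp only: tup, simp add: Q_obj_def rho_closed sigma_rho)
  also have "\<dots> = (\<lambda>a\<in>carrier G. mult G a)"
    by (intro restrict_ext extensional_restrict ext)
  also have "\<dots> = mult G" by (intro extensional_restrict ext)
  finally have m: "(\<lambda>a\<in>carrier G. \<lambda>b\<in>carrier G. theta (fst (Q_obj n (G, \<sigma>, \<rho>)))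
      (\<lambda>i\<in>{1..n}. alpha (fst (Q_obj n (G, \<sigma>, \<rho>))) i a \<one>) b) = mult G" .
  have "(\<lambda>a\<in>tuples n (carrier G). theta (fst (Q_obj n (G, \<sigma>, \<rho>))) a \<one>) =
      (\<lambda>a\<in>tuples n (carrier G). \<sigma> a)"
    by (intro restrict_ext) (simp add: Q_obj_def sigma_closed)
  also have "\<dots> = \<sigma>" using sigma_fun by (simp add: PiE_iff extensional_restrict)
  finally have s: "(\<lambda>a\<in>tuples n (carrier G). theta (fst (Q_obj n (G, \<sigma>, \<rho>))) a \<one>) = \<sigma>" .
  have "(\<lambda>a\<in>carrier G. \<lambda>i\<in>{1..n}. alpha (fst (Q_obj n (G, \<sigma>, \<rho>))) i a \<one>) =
      (\<lambda>a\<in>carrier G. \<rho> a)"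
    by (intro restrict_ext tup)
  also have "\<dots> = \<rho>" using rho_fun by (simp add: PiE_iff extensional_restrict)
  finally have r: "(\<lambda>a\<in>carrier G. \<lambda>i\<in>{1..n}. alpha (fst (Q_obj n (G, \<sigma>, \<rho>))) i a \<one>) = \<rho>" .
  have Q: "Q_obj n (G, \<sigma>, \<rho>) = (fst (Q_obj n (G, \<sigma>, \<rho>)), \<one>)"
    and car: "carrier (fst (Q_obj n (G, \<sigma>, \<rho>))) = carrier G"
    by (simp_all add: Q_obj_def)
  show ?thesis
    by (subst Q) (simp only: P_obj_def case_prod_conv car m s r, simp)
qed

text \<open>Every \<open>\<theta>\<^sub>b\<close> is \<open>\<sigma>\<close> followed by right translation by \<open>b\<close>.\<close>

lemma strict_Q:
  assumes "bij_betw \<sigma> (tuples n (carrier G)) (carrier G)"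
  shows "strict n (fst (Q_obj n (G, \<sigma>, \<rho>)))"
proof -
  have "bij_betw (\<lambda>a. \<sigma> a \<otimes> b) (tuples n (carrier G)) (carrier G)" if b: "b \<in> carrier G" for b
  proof -
    have "bij_betw (\<lambda>x. x \<otimes> b) (carrier G) (carrier G)"
      by (rule bij_betwI[where g = "\<lambda>x. x \<otimes> inv b"]) (use b in \<open>auto simp: m_assoc\<close>)
    from bij_betw_trans[OF assms this] show ?thesis by (simp add: comp_def)
  qed
  moreover have "bij_betw (\<lambda>a. theta (fst (Q_obj n (G, \<sigma>, \<rho>))) a b) (tuples n (carrier G)) (carrier G) \<longleftrightarrow>
      bij_betw (\<lambda>a. \<sigma> a \<otimes> b) (tuples n (carrier G)) (carrier G)" if "b \<in> carrier G" for b
    by (rule bij_betw_cong) (use that in \<open>simp add: Q_obj_def\<close>)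
  moreover have "carrier (fst (Q_obj n (G, \<sigma>, \<rho>))) = carrier G"
    by (simp add: Q_obj_def)
  ultimately show ?thesis
    by (simp add: strict_def)
qed

lemma bij_rho:
  assumes "bij_betw \<sigma> (tuples n (carrier G)) (carrier G)"
  shows "bij_betw \<rho> (carrier G) (tuples n (carrier G))"
proof (rule bij_betwI[where g = \<sigma>])
  show "\<rho> (\<sigma> a) = a" if "a \<in> tuples n (carrier G)" for a
    using bij_betw_imp_inj_on[OF assms] that by (auto intro: inj_onD simp: sigma_rho sigma_closed rho_closed)
qed (auto simp: rho_closed sigma_closed sigma_rho)

end

lemma y_objects_iff: "(G, \<sigma>, \<rho>) \<in> y_objects n \<longleftrightarrow> y_triple n G \<sigma> \<rho>"
  by (auto simp: y_objects_def y_triple_def y_triple_axioms_def)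

text \<open>The operations of the algebra are composites of \<open>\<sigma>\<close>, \<open>\<rho>\<close> and the group operations,
  all of which \<open>f\<close> preserves; the constants \<open>e\<^sub>i\<close> and the fixed element come from the unit.\<close>

lemma Q_hom:
  assumes "y_triple n G \<sigma> \<rho>" "y_triple n G' \<sigma>' \<rho>'" "f \<in> y_hom n (G, \<sigma>, \<rho>) (G', \<sigma>', \<rho>')"
  shows "f \<in> vn_hom n (fst (Q_obj n (G, \<sigma>, \<rho>))) (fst (Q_obj n (G', \<sigma>', \<rho>')))"
    and "f \<one>\<^bsub>G\<^esub> = \<one>\<^bsub>G'\<^esub>"
proof -
  interpret G: y_triple n G \<sigma> \<rho> by fact
  interpret G': y_triple n G' \<sigma>' \<rho>' by fact
  have hom: "f \<in> hom G G'" and ext: "f \<in> extensional (carrier G)"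
    and s: "\<And>a. a \<in> tuples n (carrier G) \<Longrightarrow> f (\<sigma> a) = \<sigma>' (map_tuple n f a)"
    and r: "\<And>a. a \<in> carrier G \<Longrightarrow> map_tuple n f (\<rho> a) = \<rho>' (f a)"
    using assms(3) by (auto simp: y_hom_def)
  interpret group_hom G G' f
    using hom by unfold_locales
  have f: "f \<in> carrier G \<rightarrow> carrier G'" by auto
  have r_nth: "f (\<rho> a i) = \<rho>' (f a) i" if "a \<in> carrier G" "i \<in> {1..n}" for a i
    using fun_cong[OF r[OF that(1)], of i] that(2) by (simp add: map_tuple_def)
  show "f \<one>\<^bsub>G\<^esub> = \<one>\<^bsub>G'\<^esub>" by simp
  show "f \<in> vn_hom n (fst (Q_obj n (G, \<sigma>, \<rho>))) (fst (Q_obj n (G', \<sigma>', \<rho>')))"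
    using f ext
    by (auto simp: vn_hom_def Q_obj_def G.sigma_closed s r_nth map_tuple_tuples[OF _ f] PiE_iff)
qed

lemma inverse_functors_P_Q: "inverse_functors (RCVcat n) (Ycat n) (P_functor n) (Q_functor n)"
  unfolding RCVcat_def Ycat_def P_functor_def Q_functor_def
proof (rule inverse_functors_concrete[OF concrete_data_rcv concrete_data_y], goal_cases)
  case (1 X)
  then show ?case by (cases X) (simp add: rcv_objects_iff pointed_rc_algebra.P_obj_closed)
next
  case (2 X)
  then show ?case by (cases X) (simp add: P_obj_def)
next
  case (3 X Y f)
  then show ?case by (cases X, cases Y) (auto simp: rcv_objects_iff intro: P_hom)
next
  case (4 X)
  then show ?case by (cases X) (simp add: y_objects_iff y_triple.Q_obj_closed)
next
  case (5 X)
  then show ?case by (cases X) (simp add: Q_obj_def)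
next
  case (6 X Y f)
  obtain G \<sigma> \<rho> G' \<sigma>' \<rho>' where XY: "X = (G, \<sigma>, \<rho>)" "Y = (G', \<sigma>', \<rho>')"
    by (cases X, cases Y)
  have "Q_obj n X = (fst (Q_obj n X), \<one>\<^bsub>G\<^esub>)" "Q_obj n Y = (fst (Q_obj n Y), \<one>\<^bsub>G'\<^esub>)"
    by (simp_all add: XY Q_obj_def)
  then show ?case
    using 6 Q_hom[of n G \<sigma> \<rho> G' \<sigma>' \<rho>' f]
    by (auto simp: XY y_objects_iff split: prod.splits)
next
  case (7 X)
  then show ?case by (cases X) (simp add: rcv_objects_iff pointed_rc_algebra.Q_P)
next
  case (8 X)
  then show ?case by (cases X) (simp add: y_objects_iff y_triple.P_Q)
qed


section \<open>Strict algebras and groups\<close>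

lemma Obj_RCVcat: "Obj (RCVcat n) = rcv_objects n"
  and Obj_Ycat: "Obj (Ycat n) = y_objects n"
  and on_obj_P_functor: "on_obj (P_functor n) = P_obj n"
  by (simp_all add: RCVcat_def Ycat_def P_functor_def concrete_cat_def concrete_functor_def)

lemma P_image_strict:
  "P_obj n ` {(A, u) \<in> rcv_objects n. strict n A} =
    {(G, \<sigma>, \<rho>) \<in> y_objects n.
      bij_betw \<sigma> (tuples n (carrier G)) (carrier G) \<and> bij_betw \<rho> (carrier G) (tuples n (carrier G))}"
  (is "?L = ?R")
proof (intro equalityI subsetI)
  fix Y assume "Y \<in> ?L"
  then obtain A u where Y: "Y = P_obj n (A, u)" and "pointed_rc_algebra n A u" and str: "strict n A"
    by (auto simp: rcv_objects_iff)
  interpret pointed_rc_algebra n A u by fact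
  obtain G \<sigma> \<rho> where eq: "P_obj n (A, u) = (G, \<sigma>, \<rho>)" by (cases "P_obj n (A, u)")
  then interpret y_triple n G \<sigma> \<rho>
    using P_obj_closed by (simp add: y_objects_iff)
  have car: "carrier G = carrier A" and s: "\<sigma> = (\<lambda>a\<in>tuples n (carrier A). theta A a u)"
    using eq by (auto simp: P_obj_eq)
  have "bij_betw \<sigma> (tuples n (carrier A)) (carrier A) \<longleftrightarrow>
      bij_betw (\<lambda>a. theta A a u) (tuples n (carrier A)) (carrier A)"
    by (rule bij_betw_cong) (simp add: s)
  then have "bij_betw \<sigma> (tuples n (carrier G)) (carrier G)"
    using str point_closed by (simp add: strict_def car)
  then show "Y \<in> ?R"
    using bij_rho P_obj_closed by (simp add: Y eq)
next
  fix Y assume "Y \<in> ?R"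
  then obtain G \<sigma> \<rho> where Y: "Y = (G, \<sigma>, \<rho>)" and "y_triple n G \<sigma> \<rho>"
    and bij: "bij_betw \<sigma> (tuples n (carrier G)) (carrier G)"
    by (auto simp: y_objects_iff)
  interpret y_triple n G \<sigma> \<rho> by fact
  have "Q_obj n Y \<in> {(A, u) \<in> rcv_objects n. strict n A}"
    using Q_obj_closed strict_Q[OF bij] by (simp add: Y case_prod_beta)
  then show "Y \<in> ?L"
    by (rule image_eqI[rotated]) (simp add: Y P_Q)
qed

lemma v1_of_group_rc:
  assumes "group G" "u \<in> carrier G"
  shows "pointed_rc_algebra 1 (v1_of_group G) u"
proof
  interpret group G by fact
  have "theta (v1_of_group G) (\<lambda>i\<in>{1..1}. alpha (v1_of_group G) i a b) b = a"
    if "a \<in> carrier G" "b \<in> carrier G" for a b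
  proof -
    have "(\<lambda>i\<in>{1..1}. alpha (v1_of_group G) i a b) \<in> tuples 1 (carrier G)"
      using that by (intro tuples_restrict) (simp add: v1_of_group_def)
    then show ?thesis
      using that by (simp add: v1_of_group_def m_assoc)
  qed
  then show "vn_algebra 1 (v1_of_group G)"
    by (auto simp: vn_algebra_def v1_of_group_def dest: tuples_nth[where i = 1])
  have "(x \<otimes>\<^bsub>G\<^esub> b) \<otimes>\<^bsub>G\<^esub> inv\<^bsub>G\<^esub> (y \<otimes>\<^bsub>G\<^esub> b) = x \<otimes>\<^bsub>G\<^esub> inv\<^bsub>G\<^esub> y"
    if "x \<in> carrier G" "y \<in> carrier G" "b \<in> carrier G" for x y b
  proof -
    have "(x \<otimes>\<^bsub>G\<^esub> b) \<otimes>\<^bsub>G\<^esub> inv\<^bsub>G\<^esub> (y \<otimes>\<^bsub>G\<^esub> b) = x \<otimes>\<^bsub>G\<^esub> (b \<otimes>\<^bsub>G\<^esub> inv\<^bsub>G\<^esub> b) \<otimes>\<^bsub>G\<^esub> inv\<^bsub>G\<^esub> y"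
      using that by (simp only: inv_mult_group m_assoc inv_closed m_closed)
    then show ?thesis using that by simp
  qed
  moreover have "a 1 \<in> carrier G" if "a \<in> tuples 1 (carrier G)" for a
    using that by (rule tuples_nth) simp
  ultimately show "right_cancellable 1 (v1_of_group G)"
    by (simp add: right_cancellable_def v1_of_group_def)
  show "u \<in> carrier (v1_of_group G)"
    using assms by (simp add: v1_of_group_def)
qed

lemma econst_v1_of_group: "econst (v1_of_group G) 1 = \<one>\<^bsub>G\<^esub>"
  by (simp add: v1_of_group_def)

lemma unit_pointed_groups_eq: "unit_pointed_groups = {(v1_of_group G, \<one>\<^bsub>G\<^esub>) | G. group G}"
  unfolding unit_pointed_groups_def pointed_groups_def
  using group.is_monoid monoid.one_closed econst_v1_of_group by fastforce

text \<open>With the unit as base point, \<open>\<theta>\<^sub>u\<close> and \<open>\<alpha>\<^sub>1(-, u)\<close> are translations by the unit. In the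
  other direction, the triple of a group with \<open>\<sigma> = \<rho> = 1\<close> is sent by \<open>Q\<close> to that group.\<close>

lemma P_image_groups: "P_obj 1 ` unit_pointed_groups = identity_triples"
proof (intro equalityI subsetI)
  fix Y assume "Y \<in> P_obj 1 ` unit_pointed_groups"
  then obtain G where Y: "Y = P_obj 1 (v1_of_group G, \<one>\<^bsub>G\<^esub>)" and "group G"
    unfolding unit_pointed_groups_eq by blast
  interpret group G by fact
  interpret pointed_rc_algebra 1 "v1_of_group G" "\<one>\<^bsub>G\<^esub>"
    using \<open>group G\<close> by (rule v1_of_group_rc) simp
  have s: "(\<lambda>a\<in>tuples 1 (carrier G). theta (v1_of_group G) a \<one>\<^bsub>G\<^esub>) = (\<lambda>a\<in>tuples 1 (carrier G). a 1)"
    by (intro restrict_ext) (auto simp: v1_of_group_def dest: tuples_nth[where i = 1])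
  have r: "(\<lambda>a\<in>carrier G. \<lambda>i\<in>{1..1}. alpha (v1_of_group G) i a \<one>\<^bsub>G\<^esub>) = (\<lambda>a\<in>carrier G. \<lambda>i\<in>{1..1}. a)"
    by (intro restrict_ext) (auto simp: v1_of_group_def)
  have car: "carrier (v1_of_group G) = carrier G" by (simp add: v1_of_group_def)
  have "Y = (fst Y, \<lambda>a\<in>tuples 1 (carrier G). a 1, \<lambda>a\<in>carrier G. \<lambda>i\<in>{1..1}. a)" "carrier (fst Y) = carrier G"
    by (simp_all only: Y P_obj_def case_prod_conv car s r fst_conv partial_object.select_convs)
  then obtain H where H: "Y = (H, \<lambda>a\<in>tuples 1 (carrier G). a 1, \<lambda>a\<in>carrier G. \<lambda>i\<in>{1..1}. a)"
      "carrier H = carrier G"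
    by blast
  show "Y \<in> identity_triples"
    unfolding identity_triples_def H(1) using P_obj_closed[folded Y, unfolded H(1)] H(2) by simp
next
  fix Y assume "Y \<in> (identity_triples :: 'a ytriple set)"
  then obtain G \<sigma> \<rho> where Y: "Y = (G, \<sigma>, \<rho>)" and "y_triple 1 G \<sigma> \<rho>"
    and s: "\<sigma> = (\<lambda>a\<in>tuples 1 (carrier G). a 1)" and r: "\<rho> = (\<lambda>a\<in>carrier G. \<lambda>i\<in>{1..1}. a)"
    by (auto simp: identity_triples_def y_objects_iff)
  interpret y_triple 1 G \<sigma> \<rho> by fact
  have th: "(\<lambda>a\<in>tuples 1 (carrier G). \<lambda>b\<in>carrier G. \<sigma> a \<otimes>\<^bsub>G\<^esub> b) =
      (\<lambda>a\<in>tuples 1 (carrier G). \<lambda>b\<in>carrier G. a 1 \<otimes>\<^bsub>G\<^esub> b)"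
    by (intro restrict_ext) (simp add: s)
  have al: "(\<lambda>i\<in>{1..1}. \<lambda>a\<in>carrier G. \<lambda>b\<in>carrier G. \<rho> (a \<otimes>\<^bsub>G\<^esub> inv\<^bsub>G\<^esub> b) i) =
      (\<lambda>i\<in>{1..1}. \<lambda>a\<in>carrier G. \<lambda>b\<in>carrier G. a \<otimes>\<^bsub>G\<^esub> inv\<^bsub>G\<^esub> b)"
    by (intro restrict_ext) (simp add: r)
  have ec: "(\<lambda>i\<in>{1..1}. \<rho> \<one>\<^bsub>G\<^esub> i) = (\<lambda>i\<in>{1..1}. \<one>\<^bsub>G\<^esub>)"
    by (intro restrict_ext) (simp add: r)
  have Q: "Q_obj 1 (G, \<sigma>, \<rho>) = (v1_of_group G, \<one>\<^bsub>G\<^esub>)"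
    by (simp only: Q_obj_def v1_of_group_def case_prod_conv th al ec)
  have "(v1_of_group G, \<one>\<^bsub>G\<^esub>) \<in> unit_pointed_groups"
    unfolding unit_pointed_groups_eq using is_group by blast
  then show "Y \<in> P_obj 1 ` unit_pointed_groups"
    by (rule image_eqI[rotated]) (simp only: Y P_Q Q[symmetric])
qed

theorem proposition5p7:
  fixes n :: nat
  assumes "n \<ge> 1"
  shows "isomorphic_categories
           (RCVcat n :: ('a pointed_valg, 'a pointed_valg \<times> ('a \<Rightarrow> 'a) \<times> 'a pointed_valg) cat)
           (Ycat n :: ('a ytriple, 'a ytriple \<times> ('a \<Rightarrow> 'a) \<times> 'a ytriple) cat) \<and>
         inverse_functors
           (RCVcat n :: ('a pointed_valg, 'a pointed_valg \<times> ('a \<Rightarrow> 'a) \<times> 'a pointed_valg) cat)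
           (Ycat n) (P_functor n) (Q_functor n) \<and>
         on_obj (P_functor n) ` {(A :: 'a valg, u) \<in> Obj (RCVcat n). strict n A} =
           {(G, \<sigma>, \<rho>) \<in> Obj (Ycat n).
              bij_betw \<sigma> (tuples n (carrier G)) (carrier G) \<and>
              bij_betw \<rho> (carrier G) (tuples n (carrier G))} \<and>
         (n = 1 \<longrightarrow>
           (pointed_groups :: 'a pointed_valg set) \<subseteq> Obj (RCVcat n) \<and>
           on_obj (P_functor n) ` (unit_pointed_groups :: 'a pointed_valg set) = identity_triples)"
proof (intro conjI impI)
  show "isomorphic_categories
      (RCVcat n :: ('a pointed_valg, 'a pointed_valg \<times> ('a \<Rightarrow> 'a) \<times> 'a pointed_valg) cat)
      (Ycat n :: ('a ytriple, 'a ytriple \<times> ('a \<Rightarrow> 'a) \<times> 'a ytriple) cat)"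
    unfolding isomorphic_categories_def using inverse_functors_P_Q by blast
  show "pointed_groups \<subseteq> Obj (RCVcat n)" if "n = 1"
    using that by (auto simp: pointed_groups_def Obj_RCVcat rcv_objects_iff intro: v1_of_group_rc[simplified])
  show "on_obj (P_functor n) ` unit_pointed_groups = identity_triples" if "n = 1"
    unfolding that on_obj_P_functor by (rule P_image_groups)
qed (simp_all only: inverse_functors_P_Q Obj_RCVcat Obj_Ycat on_obj_P_functor P_image_strict)

end
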